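(* Let $T$ be a double star with $n$ vertices. Then the least adjacency eigenvalue of $T$ is non-main if and only if $T$ is balanced.
   Context: For integers $k,s\ge1$, the double star $T(k,s)$ is the tree of order $n=k+s+2$ with vertices $1,2,\dots,k+s+2$ whose edges are $12$, $1i$ for $3\le i\le k+2$, and $2i$ for $k+3\le i\le k+s+2$ (equivalently, the trees of diameter three). It is balanced if $k=s$. An adjacency eigenvalue is main if some associated eigenvector $\mathbf{x}$ satisfies $\mathbf{j}^\top\mathbf{x}\neq0$ ($\mathbf{j}$ the all-ones vector), and non-main otherwise. *)

theory Defs
  imports "Jordan_Normal_Form.Char_Poly"
begin

text \<open>
  Graphs on the vertex set \<open>{1..n}\<close> are given by their sets of two-element edges. Matrix indices
  start at 0, so vertex \<open>i\<close> corresponds to row and column \<open>i - 1\<close>.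
\<close>

definition double_star_edges :: "nat \<Rightarrow> nat \<Rightarrow> nat set set" where
  "double_star_edges k s =
     {{1, 2}} \<union> {{1, i} | i. 3 \<le> i \<and> i \<le> k + 2} \<union> {{2, i} | i. k + 3 \<le> i \<and> i \<le> k + s + 2}"

definition adjacency_matrix :: "nat \<Rightarrow> nat set set \<Rightarrow> real mat" where
  "adjacency_matrix n E = mat n n (\<lambda>(i, j). if {i + 1, j + 1} \<in> E then 1 else 0)"

definition all_ones_vec :: "nat \<Rightarrow> real vec" where
  "all_ones_vec n = vec n (\<lambda>_. 1)"

definition main_eigenvalue :: "real mat \<Rightarrow> real \<Rightarrow> bool" where
  "main_eigenvalue A \<mu> \<longleftrightarrow>
     eigenvalue A \<mu> \<and> (\<exists>x. eigenvector A x \<mu> \<and> all_ones_vec (dim_row A) \<bullet> x \<noteq> 0)"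

definition non_main_eigenvalue :: "real mat \<Rightarrow> real \<Rightarrow> bool" where
  "non_main_eigenvalue A \<mu> \<longleftrightarrow> eigenvalue A \<mu> \<and> \<not> main_eigenvalue A \<mu>"

text \<open>
  Adjacency matrices are real symmetric, so their eigenvalues are all real, and for positive
  dimension the set below is finite and nonempty.
\<close>

definition least_eigenvalue :: "real mat \<Rightarrow> real" where
  "least_eigenvalue A = Min {\<mu>. eigenvalue A \<mu>}"

definition balanced_double_star :: "nat \<Rightarrow> nat \<Rightarrow> bool" where
  "balanced_double_star k s \<longleftrightarrow> k = s"

end

theory Submission
  imports Defs
begin

text \<open>
  Write \<open>a\<close>, \<open>b\<close> for the entries of an eigenvector at the two centres. For an eigenvalue
  \<open>\<mu> \<noteq> 0\<close> every leaf entry is \<open>a / \<mu>\<close> or \<open>b / \<mu>\<close>, so that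
  \<open>(\<mu>\<^sup>2 - k) a = \<mu> b\<close>, \<open>(\<mu>\<^sup>2 - s) b = \<mu> a\<close>, and the entries sum to zero iff
  \<open>(\<mu> + k) a + (\<mu> + s) b = 0\<close>. Eliminating \<open>b\<close>, respectively \<open>a\<close>, turns the last condition into
  \<open>\<mu>\<^sup>3 + (s + 1) \<mu>\<^sup>2 = k s\<close>, respectively \<open>\<mu>\<^sup>3 + (k + 1) \<mu>\<^sup>2 = k s\<close>, which together force
  \<open>k = s\<close>. Conversely, if \<open>k = s\<close> then \<open>\<mu>\<^sup>2 - k = \<plusminus>\<mu>\<close>, and the least eigenvalue takes the minus
  sign, hence \<open>b = -a\<close> and the entries cancel.
\<close>

text \<open>The pieces follow the shape of the tree, with indices shifted down by one: the centres
  are 0 and 1, followed by the leaves at the first centre and then those at the second.\<close>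

lemma sum_double_star_vertices:
  fixes f :: "nat \<Rightarrow> 'a::comm_monoid_add"
  shows "(\<Sum>j\<in>{0..<k + s + 2}. f j) = f 0 + f 1 + (\<Sum>j\<in>{2..<k + 2}. f j) + (\<Sum>j\<in>{k + 2..<k + s + 2}. f j)"
proof -
  have "(\<Sum>j\<in>{0..<k + s + 2}. f j) = (\<Sum>j\<in>{0..<2}. f j) + (\<Sum>j\<in>{2..<k + s + 2}. f j)"
    by (rule sum.atLeastLessThan_concat[symmetric]) auto
  also have "(\<Sum>j\<in>{2..<k + s + 2}. f j) = (\<Sum>j\<in>{2..<k + 2}. f j) + (\<Sum>j\<in>{k + 2..<k + s + 2}. f j)"
    by (rule sum.atLeastLessThan_concat[symmetric]) auto
  also have "(\<Sum>j\<in>{0..<2}. f j) = f 0 + f 1"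
    by (simp add: numeral_2_eq_2)
  finally show ?thesis by (simp add: add.assoc)
qed

lemma double_star_edges_iff:
  assumes "i < k + s + 2" "j < k + s + 2"
  shows "{i + 1, j + 1} \<in> double_star_edges k s \<longleftrightarrow>
    (if i = 0 then 1 \<le> j \<and> j < k + 2
     else if i = 1 then j = 0 \<or> k + 2 \<le> j
     else if i < k + 2 then j = 0 else j = 1)"
  using assms unfolding double_star_edges_def
  by (auto simp: doubleton_eq_iff)

lemma double_star_mult_vec:
  assumes "x \<in> carrier_vec (k + s + 2)" "i < k + s + 2"
  shows "(adjacency_matrix (k + s + 2) (double_star_edges k s) *\<^sub>v x) $ i =
    (if i = 0 then x $ 1 + (\<Sum>j\<in>{2..<k + 2}. x $ j)
     else if i = 1 then x $ 0 + (\<Sum>j\<in>{k + 2..<k + s + 2}. x $ j)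
     else if i < k + 2 then x $ 0 else x $ 1)"
proof -
  let ?e = "\<lambda>j. if {i + 1, j + 1} \<in> double_star_edges k s then x $ j else 0"
  have "(adjacency_matrix (k + s + 2) (double_star_edges k s) *\<^sub>v x) $ i = (\<Sum>j\<in>{0..<k + s + 2}. ?e j)"
    using assms unfolding adjacency_matrix_def
    by (auto simp: scalar_prod_def intro!: sum.cong)
  also have "\<dots> = (\<Sum>j\<in>{0..<k + s + 2}.
     if (if i = 0 then 1 \<le> j \<and> j < k + 2
     else if i = 1 then j = 0 \<or> k + 2 \<le> j
     else if i < k + 2 then j = 0 else j = 1) then x $ j else 0)"
    using double_star_edges_iff[OF assms(2)] by (intro sum.cong) auto
  finally show ?thesis
    unfolding sum_double_star_vertices by (auto intro!: sum.neutral)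
qed

lemma eigenvector_double_star_iff:
  fixes x :: "real vec"
  shows "eigenvector (adjacency_matrix (k + s + 2) (double_star_edges k s)) x \<mu> \<longleftrightarrow>
    x \<in> carrier_vec (k + s + 2) \<and> x \<noteq> 0\<^sub>v (k + s + 2) \<and>
    x $ 1 + (\<Sum>j\<in>{2..<k + 2}. x $ j) = \<mu> * x $ 0 \<and>
    x $ 0 + (\<Sum>j\<in>{k + 2..<k + s + 2}. x $ j) = \<mu> * x $ 1 \<and>
    (\<forall>j\<in>{2..<k + 2}. x $ 0 = \<mu> * x $ j) \<and>
    (\<forall>j\<in>{k + 2..<k + s + 2}. x $ 1 = \<mu> * x $ j)"
    (is "eigenvector ?A x \<mu> \<longleftrightarrow> ?x \<and> ?nz \<and> ?eqs")
proof -
  have dim: "dim_row ?A = k + s + 2"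
    by (simp add: adjacency_matrix_def)
  have "?A *\<^sub>v x = \<mu> \<cdot>\<^sub>v x \<longleftrightarrow> ?eqs" if x: ?x
  proof -
    have "?A *\<^sub>v x = \<mu> \<cdot>\<^sub>v x \<longleftrightarrow> (\<forall>i<k + s + 2. (?A *\<^sub>v x) $ i = \<mu> * x $ i)"
      using x dim by (auto simp: vec_eq_iff)
    also have "\<dots> \<longleftrightarrow> (\<forall>i<k + s + 2. (if i = 0 then x $ 1 + (\<Sum>j\<in>{2..<k + 2}. x $ j)
     else if i = 1 then x $ 0 + (\<Sum>j\<in>{k + 2..<k + s + 2}. x $ j)
     else if i < k + 2 then x $ 0 else x $ 1) = \<mu> * x $ i)"
      using double_star_mult_vec[OF x] by auto
    also have "\<dots> \<longleftrightarrow> ?eqs" (is "?P \<longleftrightarrow> _")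
    proof
      assume P: ?P
      have "x $ 0 = \<mu> * x $ j" if "j \<in> {2..<k + 2}" for j
        using P[rule_format, of j] that by simp
      moreover have "x $ 1 = \<mu> * x $ j" if "j \<in> {k + 2..<k + s + 2}" for j
        using P[rule_format, of j] that by simp
      moreover have "x $ 1 + (\<Sum>j\<in>{2..<k + 2}. x $ j) = \<mu> * x $ 0"
        using P[rule_format, of 0] by simp
      moreover have "x $ 0 + (\<Sum>j\<in>{k + 2..<k + s + 2}. x $ j) = \<mu> * x $ 1"
        using P[rule_format, of 1] by simp
      ultimately show ?eqs by blast
    qed auto
    finally show ?thesis .
  qed
  then show ?thesis
    unfolding eigenvector_def dim by blast
qed

lemma eigenvector_double_star_leaves:
  assumes "eigenvector (adjacency_matrix (k + s + 2) (double_star_edges k s)) x \<mu>" and "\<mu> \<noteq> 0"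
  shows "(\<mu>\<^sup>2 - k) * x $ 0 = \<mu> * x $ 1"
    and "(\<mu>\<^sup>2 - s) * x $ 1 = \<mu> * x $ 0"
    and "\<mu> * (all_ones_vec (k + s + 2) \<bullet> x) = (\<mu> + k) * x $ 0 + (\<mu> + s) * x $ 1"
    and "x $ 0 \<noteq> 0" and "x $ 1 \<noteq> 0"
proof -
  note ev = assms(1)[unfolded eigenvector_double_star_iff]
  have leaf0: "x $ j = x $ 0 / \<mu>" if "j \<in> {2..<k + 2}" for j
    using ev that \<open>\<mu> \<noteq> 0\<close> by (simp add: field_simps)
  have leaf1: "x $ j = x $ 1 / \<mu>" if "j \<in> {k + 2..<k + s + 2}" for j
    using ev that \<open>\<mu> \<noteq> 0\<close> by (simp add: field_simps)
  have S0: "(\<Sum>j\<in>{2..<k + 2}. x $ j) = k * (x $ 0 / \<mu>)"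
    using leaf0 by simp
  have S1: "(\<Sum>j\<in>{k + 2..<k + s + 2}. x $ j) = s * (x $ 1 / \<mu>)"
    using leaf1 by simp
  show e0: "(\<mu>\<^sup>2 - k) * x $ 0 = \<mu> * x $ 1"
    using ev \<open>\<mu> \<noteq> 0\<close> unfolding S0 by (simp add: field_simps power2_eq_square)
  show e1: "(\<mu>\<^sup>2 - s) * x $ 1 = \<mu> * x $ 0"
    using ev \<open>\<mu> \<noteq> 0\<close> unfolding S1 by (simp add: field_simps power2_eq_square)
  have "all_ones_vec (k + s + 2) \<bullet> x = (\<Sum>j\<in>{0..<k + s + 2}. x $ j)"
    using ev by (auto simp: all_ones_vec_def scalar_prod_def intro!: sum.cong)
  then show "\<mu> * (all_ones_vec (k + s + 2) \<bullet> x) = (\<mu> + k) * x $ 0 + (\<mu> + s) * x $ 1"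
    using \<open>\<mu> \<noteq> 0\<close> unfolding sum_double_star_vertices S0 S1 by (simp add: field_simps)
  \<comment> \<open>Since \<mu> is nonzero, \<open>e0\<close> and \<open>e1\<close> make both centre
    entries vanish as soon as one does. So it is enough to exclude that both vanish, and in that
    case all leaf entries would be 0 as well.\<close>
  have "\<not> (x $ 0 = 0 \<and> x $ 1 = 0)"
  proof
    assume z: "x $ 0 = 0 \<and> x $ 1 = 0"
    have "x $ j = 0" if "j < k + s + 2" for j
    proof -
      have "j = 0 \<or> j = 1 \<or> j \<in> {2..<k + 2} \<or> j \<in> {k + 2..<k + s + 2}"
        using that by auto
      then show ?thesis using z leaf0 leaf1 by auto
    qed
    then have "x = 0\<^sub>v (k + s + 2)" using ev by (intro eq_vecI) auto
    then show False using ev by blast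
  qed
  then show "x $ 0 \<noteq> 0" "x $ 1 \<noteq> 0"
    using e0 e1 \<open>\<mu> \<noteq> 0\<close> by auto
qed

text \<open>The hypothesis is the product of the two centre equations with the centre entries
  cancelled, that is, the condition for them to have a nonzero solution.\<close>

lemma eigenvalue_double_starI:
  fixes \<mu> :: real
  assumes "\<mu> \<noteq> 0" and "(\<mu>\<^sup>2 - k) * (\<mu>\<^sup>2 - s) = \<mu>\<^sup>2"
  shows "eigenvalue (adjacency_matrix (k + s + 2) (double_star_edges k s)) \<mu>"
proof -
  \<comment> \<open>The first centre equation is solved by \<open>a = \<mu>\<close> and
    \<open>b = \<mu>\<^sup>2 - k\<close>; leaf entries are then \<open>a / \<mu>\<close> and
    \<open>b / \<mu>\<close>. Only the equation at the second centre is left to use the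
    hypothesis.\<close>
  define x where "x = vec (k + s + 2) (\<lambda>i. if i = 0 then \<mu> else if i = 1 then \<mu>\<^sup>2 - k
    else if i < k + 2 then 1 else (\<mu>\<^sup>2 - k) / \<mu>)"
  have x01: "x $ 0 = \<mu>" "x $ 1 = \<mu>\<^sup>2 - k"
    by (simp_all add: x_def)
  have leaf0: "x $ j = 1" if "j \<in> {2..<k + 2}" for j
    using that by (simp add: x_def)
  have leaf1: "x $ j = (\<mu>\<^sup>2 - k) / \<mu>" if "j \<in> {k + 2..<k + s + 2}" for j
    using that by (simp add: x_def)
  have "x \<noteq> 0\<^sub>v (k + s + 2)"
    using x01 \<open>\<mu> \<noteq> 0\<close> by auto
  moreover have "x $ 0 + (\<Sum>j\<in>{k + 2..<k + s + 2}. x $ j) = \<mu> * x $ 1"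
  proof -
    have "\<mu> * (x $ 0 + s * ((\<mu>\<^sup>2 - k) / \<mu>)) = \<mu> * (\<mu> * x $ 1)"
    proof -
      have "\<mu> * (x $ 0 + s * ((\<mu>\<^sup>2 - k) / \<mu>)) = \<mu>\<^sup>2 + s * (\<mu>\<^sup>2 - k)"
        using \<open>\<mu> \<noteq> 0\<close> unfolding x01 by (simp add: distrib_left power2_eq_square)
      also have "\<dots> = \<mu> * (\<mu> * x $ 1)"
        using assms(2) unfolding x01 by (simp add: algebra_simps power2_eq_square)
      finally show ?thesis .
    qed
    then show ?thesis using \<open>\<mu> \<noteq> 0\<close> leaf1 by simp
  qed
  moreover have "x $ 1 + (\<Sum>j\<in>{2..<k + 2}. x $ j) = \<mu> * x $ 0"
    using leaf0 x01 by (simp add: power2_eq_square)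
  ultimately have "eigenvector (adjacency_matrix (k + s + 2) (double_star_edges k s)) x \<mu>"
    unfolding eigenvector_double_star_iff using x01 leaf0 leaf1 \<open>\<mu> \<noteq> 0\<close>
    by (simp add: x_def)
  then show ?thesis unfolding eigenvalue_def by blast
qed

text \<open>This forces the least eigenvalue below zero, so that division by it in the leaf formulas
  is legitimate.\<close>

lemma double_star_negative_eigenvalue:
  obtains \<mu> where "\<mu> < 0" "eigenvalue (adjacency_matrix (k + s + 2) (double_star_edges k s)) \<mu>"
proof -
  \<comment> \<open>With \<open>t = \<mu>\<^sup>2\<close> the eigenvalue condition becomes the
    quadratic \<open>(t - k) * (t - s) = t\<close>. Its discriminant is \<open>d\<close> and its
    larger root is \<open>t\<close>, which is positive and so has a real square root.\<close>
  define d where "d = (real k + s + 1)\<^sup>2 - 4 * k * s"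
  define t where "t = (real k + s + 1 + sqrt d) / 2"
  have "d = (real k - s)\<^sup>2 + 2 * (real k + s) + 1"
    by (simp add: d_def power2_eq_square algebra_simps)
  then have "d \<ge> 0" by simp
  then have "t > 0" by (simp add: t_def add_pos_nonneg)
  have "2 * t - (real k + s + 1) = sqrt d"
    by (simp add: t_def field_simps)
  then have "(2 * t - (real k + s + 1))\<^sup>2 = d"
    using \<open>d \<ge> 0\<close> by simp
  then have "(t - k) * (t - s) = t"
    by (simp add: d_def power2_eq_square algebra_simps)
  then show thesis
    using that[of "- sqrt t"] eigenvalue_double_starI[of "- sqrt t" k s] \<open>t > 0\<close> by simp
qed

text \<open>Finiteness is what makes the \<open>Min\<close> in \<open>least_eigenvalue\<close> an
  attained lower bound.\<close>

lemma finite_eigenvalues: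
  fixes A :: "'a::field mat"
  assumes "A \<in> carrier_mat n n"
  shows "finite {\<mu>. eigenvalue A \<mu>}"
proof -
  have "char_poly A \<noteq> 0"
    using degree_monic_char_poly[OF assms] by auto
  then show ?thesis
    unfolding eigenvalue_root_char_poly[OF assms] by (rule poly_roots_finite)
qed

lemma non_main_double_star_imp_balanced:
  assumes "non_main_eigenvalue (adjacency_matrix (k + s + 2) (double_star_edges k s)) \<mu>" and "\<mu> \<noteq> 0"
  shows "k = s"
proof -
  let ?A = "adjacency_matrix (k + s + 2) (double_star_edges k s)"
  obtain x where x: "eigenvector ?A x \<mu>"
    using assms unfolding non_main_eigenvalue_def eigenvalue_def by blast
  have "dim_row ?A = k + s + 2"
    by (simp add: adjacency_matrix_def)
  then have "all_ones_vec (k + s + 2) \<bullet> x = 0"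
    using assms x unfolding non_main_eigenvalue_def main_eigenvalue_def by metis
  note E = eigenvector_double_star_leaves[OF x \<open>\<mu> \<noteq> 0\<close>]
  have sum0: "(\<mu> + k) * x $ 0 + (\<mu> + s) * x $ 1 = 0"
    using E(3) \<open>all_ones_vec (k + s + 2) \<bullet> x = 0\<close> by simp
  \<comment> \<open>The multipliers \<mu> and \<open>\<mu> + s\<close> are chosen so that the terms
    in \<open>x $ 1\<close> cancel; both brackets are zero.\<close>
  have "x $ 0 * (\<mu> ^ 3 + (s + 1) * \<mu>\<^sup>2 - k * s) =
      \<mu> * ((\<mu> + k) * x $ 0 + (\<mu> + s) * x $ 1) + (\<mu> + s) * ((\<mu>\<^sup>2 - k) * x $ 0 - \<mu> * x $ 1)"
    by (simp add: algebra_simps power2_eq_square power3_eq_cube)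
  then have 0: "\<mu> ^ 3 + (s + 1) * \<mu>\<^sup>2 - k * s = 0"
    using sum0 E(1,4) by simp
  have "x $ 1 * (\<mu> ^ 3 + (k + 1) * \<mu>\<^sup>2 - k * s) =
      \<mu> * ((\<mu> + k) * x $ 0 + (\<mu> + s) * x $ 1) + (\<mu> + k) * ((\<mu>\<^sup>2 - s) * x $ 1 - \<mu> * x $ 0)"
    by (simp add: algebra_simps power2_eq_square power3_eq_cube)
  then have 1: "\<mu> ^ 3 + (k + 1) * \<mu>\<^sup>2 - k * s = 0"
    using sum0 E(2,5) by simp
  \<comment> \<open>The two cubics differ only in their quadratic coefficients.\<close>
  have "(real k - s) * \<mu>\<^sup>2 = 0"
    using arg_cong2[OF 1 0, of "(-)"] by (simp only: of_nat_add of_nat_1 algebra_simps)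
  then show ?thesis using \<open>\<mu> \<noteq> 0\<close> by simp
qed

lemma balanced_double_star_eigenvector:
  assumes "eigenvector (adjacency_matrix (k + k + 2) (double_star_edges k k)) x \<mu>" and "\<mu> \<noteq> 0"
  shows "\<mu>\<^sup>2 = k + \<mu> \<or> all_ones_vec (k + k + 2) \<bullet> x = 0"
proof -
  note E = eigenvector_double_star_leaves[OF assms]
  \<comment> \<open>For \<open>k = s\<close> the centre equations are swapped by exchanging the
    centres, so adding them leaves an equation in \<open>x $ 0 + x $ 1\<close> alone.\<close>
  have "(\<mu>\<^sup>2 - k + \<mu>) * (x $ 0 + x $ 1) = 2 * \<mu> * (x $ 0 + x $ 1)"
    using E(1,2) by (simp add: algebra_simps)
  then have "\<mu>\<^sup>2 = k + \<mu> \<or> x $ 0 + x $ 1 = 0"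
    by auto
  moreover have "\<mu> * (all_ones_vec (k + k + 2) \<bullet> x) = (\<mu> + k) * (x $ 0 + x $ 1)"
    using E(3) by (simp add: algebra_simps)
  ultimately show ?thesis using \<open>\<mu> \<noteq> 0\<close> by auto
qed

theorem theorem4p6:
  fixes k s n :: nat and A :: "real mat"
  assumes "k \<ge> 1" and "s \<ge> 1" and "n = k + s + 2"
    and "A = adjacency_matrix n (double_star_edges k s)"
  shows "non_main_eigenvalue A (least_eigenvalue A) \<longleftrightarrow> balanced_double_star k s"
proof -
  let ?m = "least_eigenvalue A"
  have A: "A = adjacency_matrix (k + s + 2) (double_star_edges k s)"
    using assms by simp
  have carrier: "A \<in> carrier_mat n n"
    unfolding assms(4) by (simp add: adjacency_matrix_def)
  have fin: "finite {\<mu>. eigenvalue A \<mu>}"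
    using finite_eigenvalues[OF carrier] .
  have least: "?m \<le> \<mu>" if "eigenvalue A \<mu>" for \<mu>
    unfolding least_eigenvalue_def using fin that by simp
  obtain \<nu> where \<nu>: "\<nu> < 0" "eigenvalue A \<nu>"
    using double_star_negative_eigenvalue unfolding A by metis
  then have neg: "?m < 0" using least by fastforce
  have ev: "eigenvalue A ?m"
    using Min_in[OF fin] \<nu> unfolding least_eigenvalue_def by blast
  show ?thesis
    unfolding balanced_double_star_def
  proof
    assume "non_main_eigenvalue A ?m"
    then show "k = s"
      using non_main_double_star_imp_balanced[of k s ?m] neg A by simp
  next
    assume "k = s"
    \<comment> \<open>In the balanced case the eigenvalue condition
      \<open>(\<mu>\<^sup>2 - k)\<^sup>2 = \<mu>\<^sup>2\<close> splits by sign; \<open>m0\<close>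
      is the negative root of the branch \<open>\<mu>\<^sup>2 = k - \<mu>\<close>.\<close>
    define m0 where "m0 = - (1 + sqrt (1 + 4 * k)) / 2"
    have m0_eq: "2 * m0 + 1 = - sqrt (1 + 4 * k)"
      by (simp add: m0_def field_simps)
    then have "(2 * m0 + 1)\<^sup>2 = 1 + 4 * k"
      by simp
    then have m0: "m0\<^sup>2 = k - m0"
      by (simp add: power2_eq_square algebra_simps)
    have "2 * m0 + 1 \<le> 0"
      unfolding m0_eq by simp
    then have "m0 < 0" by linarith
    have "eigenvalue A m0"
      unfolding A \<open>k = s\<close>
      by (rule eigenvalue_double_starI)
        (use m0 \<open>m0 < 0\<close> \<open>k = s\<close> in \<open>auto simp: power2_eq_square\<close>)
    then have "?m \<le> m0" by (rule least)
    \<comment> \<open>The least eigenvalue need not be computed: being at most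
      \<open>m0 < 0\<close>, its square is at least \<open>k - m0 > k\<close>, while
      \<open>k + ?m < k\<close>. This rules out the plus branch.\<close>
    then have "m0\<^sup>2 \<le> ?m\<^sup>2"
      using \<open>m0 < 0\<close> by (simp add: abs_le_square_iff[symmetric])
    then have "?m\<^sup>2 \<noteq> k + ?m"
      using m0 \<open>m0 < 0\<close> neg by linarith
    then have "all_ones_vec (dim_row A) \<bullet> x = 0" if "eigenvector A x ?m" for x
      using balanced_double_star_eigenvector[of k x ?m] that neg carrier \<open>k = s\<close> assms(3,4) by auto
    then show "non_main_eigenvalue A ?m"
      unfolding non_main_eigenvalue_def main_eigenvalue_def using ev by blast
  qed
qed

end
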